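(* (Completeness of term equality.) Let $\Sigma$ be a CoLF signature and let $M,M'$ be rational terms over $\Sigma$ with free variables from the list of distinct variables $\Theta$. If $\exp(M)=\exp(M')$, then $\cdot;\Theta\vdash_\Sigma M=M'$ is derivable.
   Context: CoLF syntax: signature declarations $a:K$, $c:A$, $r:A=M$ (recursion constants, definitions may refer to any recursion constant of $\Sigma$); canonical terms $M::=H\cdot S\mid\lambda x.M$, heads $H::=x\mid c\mid r$, spines $S::=()\mid M;S\mid[x];S$ ($[x]$ a prepattern argument, a variable). Rational terms are such terms whose recursion constants are declared in $\Sigma$. $S\ \mathsf{prepat}$: $S$ consists only of prepattern arguments. $M\ \mathsf{contra}$: the head of $M$ (under its $\lambda$'s) is a constructor or a variable. Simple types $\tau::=*\mid\tau_1\to\tau_2$; $(\Pi x{:}A_2.A_1)^o=A_2^o\to A_1^o$, $(\Pi x\,\hat{:}\,A_2.A_1)^o=*\to A_1^o$, atomic types erase to $*$. Renaming $\{y/x\}$; reduction of a spine against a term: $()\rhd^*R=R$, $(N;S)\rhd^{\tau_2\to\tau_1}(\lambda x.M)=S\rhd^{\tau_1}([N/x]^{\tau_2}M)$, $([y];S)\rhd^{*\to\tau_1}(\lambda x.M)=S\rhd^{\tau_1}(\{y/x\}M)$, where $[N/x]^\tau$ is hereditary substitution. Equality judgment $\Delta;\Theta\vdash_\Sigma M=M'$ ($\Delta$ a list of assumptions $\Theta'\vdash H\cdot S_1\doteq H'\cdot S_2$): (1) if such an assumption is in $\Delta$ and $\sigma$ is a variable renaming from $\Theta'$ into $\Theta$,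 conclude $\sigma(H\cdot S_1)=\sigma(H'\cdot S_2)$; (2) if $r:A=M\in\Sigma$, $S_1\ \mathsf{prepat}$, $M\ \mathsf{contra}$ and $\Delta,(\Theta\vdash r\cdot S_1\doteq H\cdot S_2);\Theta\vdash S_1\rhd^{A^o}M=H\cdot S_2$, conclude $r\cdot S_1=H\cdot S_2$; (3) if $r:A=M\in\Sigma$, $S_2\ \mathsf{prepat}$, $M\ \mathsf{contra}$, $H$ not a recursion constant and $\Delta,(\Theta\vdash H\cdot S_1\doteq r\cdot S_2);\Theta\vdash H\cdot S_1=S_2\rhd^{A^o}M$, conclude $H\cdot S_1=r\cdot S_2$; (4) $c\cdot S=c\cdot S'$ from $S=S'$; (5) $y\cdot S=y\cdot S'$ from $S=S'$; (6) $\lambda x.M=\lambda x.M'$ from $\Delta;\Theta,x\vdash M=M'$; spines: $()=()$, $M;S=M';S'$ from both components, $[x];S=[x];S'$ from $S=S'$. Expansion: $\exp^{[0]}(\cdot)=\bot$; $\exp^{[k+1]}(\lambda x.M)=\lambda x.\exp^{[k+1]}(M)$; $\exp^{[k+1]}(c\cdot S)=c\cdot\exp^{[k]}(S)$; $\exp^{[k+1]}(x\cdot S)=x\cdot\exp^{[k]}(S)$; $\exp^{[k+1]}(r\cdot S)=\exp^{[k+1]}(S\rhd^{A^o}M)$ if $r:A=M\in\Sigma$, $S\ \mathsf{prepat}$; spines componentwise, prepattern arguments kept. $\exp(M)$ is the (possibly infinite) Böhm tree that is the limit of the finite approximations $\exp^{[k]}(M)$, $k\in\mathbb N$.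
   Formalization: The signature is assumed to have contractive (and closed) recursion definitions, as CoLF validity demands; without this r = r', r' = c has exp(r) = exp(c) but r = c is not derivable. Equality of expansions is read as both being defined and equal. *)

theory Defs
  imports Main
begin

text \<open>
  Terms are taken modulo renaming of bound variables by using de Bruijn indices.  A context
  \<open>\<Theta>\<close>, i.e. a list of distinct variables, is represented by its length \<open>n\<close>: its variables are
  the indices \<open>i < n\<close>, and the extension \<open>\<Theta>, x\<close> is \<open>Suc n\<close> with \<open>x\<close> as the new index 0.
\<close>

subsection \<open>Syntax\<close>

type_synonym name = string

datatype head = Var nat | Con name | Rec name

datatype tm = Neu head spine | Lam tm
  and spine = Nil_sp | Arg tm spine | PArg nat spine

datatype ty = Atom name spine | Pi ty ty | PPi ty ty

datatype kind = Type | Cotype | KPi ty kind | KPPi ty kind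

datatype decl = Fam_decl name kind | Con_decl name ty | Rec_decl name ty tm

type_synonym signature = "decl list"

fun decl_name :: "decl \<Rightarrow> name" where
  "decl_name (Fam_decl a K) = a"
| "decl_name (Con_decl c A) = c"
| "decl_name (Rec_decl r A M) = r"

text \<open>\<open>scoped_tm n M\<close>: the free variables of \<open>M\<close> belong to the context of length \<open>n\<close>.\<close>

fun scoped_head :: "nat \<Rightarrow> head \<Rightarrow> bool" where
  "scoped_head n (Var x) \<longleftrightarrow> x < n"
| "scoped_head n (Con c) \<longleftrightarrow> True"
| "scoped_head n (Rec r) \<longleftrightarrow> True"

fun scoped_tm :: "nat \<Rightarrow> tm \<Rightarrow> bool" and scoped_spine :: "nat \<Rightarrow> spine \<Rightarrow> bool" where
  "scoped_tm n (Neu H S) \<longleftrightarrow> scoped_head n H \<and> scoped_spine n S"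
| "scoped_tm n (Lam M) \<longleftrightarrow> scoped_tm (Suc n) M"
| "scoped_spine n Nil_sp \<longleftrightarrow> True"
| "scoped_spine n (Arg M S) \<longleftrightarrow> scoped_tm n M \<and> scoped_spine n S"
| "scoped_spine n (PArg x S) \<longleftrightarrow> x < n \<and> scoped_spine n S"

fun recs_head :: "head \<Rightarrow> name set" where
  "recs_head (Rec r) = {r}"
| "recs_head _ = {}"

primrec recs_tm :: "tm \<Rightarrow> name set" and recs_spine :: "spine \<Rightarrow> name set" where
  "recs_tm (Neu H S) = recs_head H \<union> recs_spine S"
| "recs_tm (Lam M) = recs_tm M"
| "recs_spine Nil_sp = {}"
| "recs_spine (Arg M S) = recs_tm M \<union> recs_spine S"
| "recs_spine (PArg x S) = recs_spine S"

definition rational :: "signature \<Rightarrow> tm \<Rightarrow> bool" where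
  "rational \<Sigma> M \<longleftrightarrow> (\<forall>r \<in> recs_tm M. \<exists>A N. Rec_decl r A N \<in> set \<Sigma>)"

primrec prepat :: "spine \<Rightarrow> bool" where
  "prepat Nil_sp \<longleftrightarrow> True"
| "prepat (Arg M S) \<longleftrightarrow> False"
| "prepat (PArg x S) \<longleftrightarrow> prepat S"

fun contra :: "tm \<Rightarrow> bool" where
  "contra (Neu H S) \<longleftrightarrow> (\<forall>r. H \<noteq> Rec r)"
| "contra (Lam M) \<longleftrightarrow> contra M"

text \<open>
  The typing conditions on signatures are not imposed: only the consequences that no name is
  declared twice and that every recursion constant has a closed contractive rational definition.
\<close>

definition colf_signature :: "signature \<Rightarrow> bool" where
  "colf_signature \<Sigma> \<longleftrightarrow>
     distinct (map decl_name \<Sigma>) \<and>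
     (\<forall>r A M. Rec_decl r A M \<in> set \<Sigma> \<longrightarrow> scoped_tm 0 M \<and> rational \<Sigma> M \<and> contra M)"

subsection \<open>Renaming, hereditary substitution and reduction\<close>

datatype sty = Star | Arr sty sty

primrec erase :: "ty \<Rightarrow> sty" where
  "erase (Atom a S) = Star"
| "erase (Pi A2 A1) = Arr (erase A2) (erase A1)"
| "erase (PPi A2 A1) = Arr Star (erase A1)"

fun ren_head :: "(nat \<Rightarrow> nat) \<Rightarrow> head \<Rightarrow> head" where
  "ren_head \<sigma> (Var x) = Var (\<sigma> x)"
| "ren_head \<sigma> (Con c) = Con c"
| "ren_head \<sigma> (Rec r) = Rec r"

definition lift :: "(nat \<Rightarrow> nat) \<Rightarrow> nat \<Rightarrow> nat" where
  "lift \<sigma> = case_nat 0 (\<lambda>i. Suc (\<sigma> i))"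

fun ren_tm :: "(nat \<Rightarrow> nat) \<Rightarrow> tm \<Rightarrow> tm" and ren_spine :: "(nat \<Rightarrow> nat) \<Rightarrow> spine \<Rightarrow> spine" where
  "ren_tm \<sigma> (Neu H S) = Neu (ren_head \<sigma> H) (ren_spine \<sigma> S)"
| "ren_tm \<sigma> (Lam M) = Lam (ren_tm (lift \<sigma>) M)"
| "ren_spine \<sigma> Nil_sp = Nil_sp"
| "ren_spine \<sigma> (Arg M S) = Arg (ren_tm \<sigma> M) (ren_spine \<sigma> S)"
| "ren_spine \<sigma> (PArg x S) = PArg (\<sigma> x) (ren_spine \<sigma> S)"

text \<open>
  \<open>hsub_tm \<tau> N x M\<close> is \<open>[N/x]\<^sup>\<tau> M\<close>; the indices above \<open>x\<close> are lowered since \<open>x\<close> disappears from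
  the context.  It is undefined if \<open>x\<close> occurs as a prepattern argument, which can only be renamed.
  \<open>reduce \<tau> S M\<close> is the reduction of the spine \<open>S\<close> against \<open>M\<close>; in the clause for the empty spine
  at type \<open>*\<close> the term has to be neutral.
\<close>

definition lower :: "nat \<Rightarrow> nat \<Rightarrow> nat" where
  "lower x y = (if x < y then y - 1 else y)"

function (sequential)
  hsub_tm :: "sty \<Rightarrow> tm \<Rightarrow> nat \<Rightarrow> tm \<Rightarrow> tm option" and
  hsub_spine :: "sty \<Rightarrow> tm \<Rightarrow> nat \<Rightarrow> spine \<Rightarrow> spine option" and
  reduce :: "sty \<Rightarrow> spine \<Rightarrow> tm \<Rightarrow> tm option" where
  "hsub_tm \<tau> N x (Lam M) = map_option Lam (hsub_tm \<tau> (ren_tm Suc N) (Suc x) M)"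
| "hsub_tm \<tau> N x (Neu (Var y) S) =
     (case hsub_spine \<tau> N x S of
        None \<Rightarrow> None
      | Some S' \<Rightarrow> if y = x then reduce \<tau> S' N else Some (Neu (Var (lower x y)) S'))"
| "hsub_tm \<tau> N x (Neu H S) = map_option (Neu H) (hsub_spine \<tau> N x S)"
| "hsub_spine \<tau> N x Nil_sp = Some Nil_sp"
| "hsub_spine \<tau> N x (Arg M S) =
     (case hsub_tm \<tau> N x M of
        None \<Rightarrow> None
      | Some M' \<Rightarrow> map_option (Arg M') (hsub_spine \<tau> N x S))"
| "hsub_spine \<tau> N x (PArg y S) =
     (if y = x then None else map_option (PArg (lower x y)) (hsub_spine \<tau> N x S))"
| "reduce Star Nil_sp (Neu H S) = Some (Neu H S)"
| "reduce (Arr \<tau>2 \<tau>1) (Arg N S) (Lam M) =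
     (case hsub_tm \<tau>2 N 0 M of None \<Rightarrow> None | Some M' \<Rightarrow> reduce \<tau>1 S M')"
| "reduce (Arr Star \<tau>1) (PArg y S) (Lam M) = reduce \<tau>1 S (ren_tm (case_nat y (\<lambda>i. i)) M)"
| "reduce _ _ _ = None"
  by pat_completeness auto

termination
  by (relation "measures
       [case_sum (\<lambda>(\<tau>, N, x, M). size \<tau>)
          (case_sum (\<lambda>(\<tau>, N, x, S). size \<tau>) (\<lambda>(\<tau>, S, M). size \<tau>)),
        case_sum (\<lambda>(\<tau>, N, x, M). Suc (size M))
          (case_sum (\<lambda>(\<tau>, N, x, S). Suc (size S)) (\<lambda>(\<tau>, S, M). 0))]") auto

subsection \<open>Term equality\<close>

text \<open>An assumption \<open>(n, N1, N2)\<close> stands for \<open>\<Theta> \<turnstile> N1 \<doteq> N2\<close>, where \<open>\<Theta>\<close> has length \<open>n\<close>.\<close>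

type_synonym assumption = "nat \<times> tm \<times> tm"

inductive
  eq_tm :: "signature \<Rightarrow> assumption list \<Rightarrow> nat \<Rightarrow> tm \<Rightarrow> tm \<Rightarrow> bool" and
  eq_spine :: "signature \<Rightarrow> assumption list \<Rightarrow> nat \<Rightarrow> spine \<Rightarrow> spine \<Rightarrow> bool"
  for \<Sigma> :: signature where
  eq_assm:
    "\<lbrakk> (m, Neu H S1, Neu H' S2) \<in> set \<Delta>; \<forall>i<m. \<sigma> i < n \<rbrakk>
     \<Longrightarrow> eq_tm \<Sigma> \<Delta> n (ren_tm \<sigma> (Neu H S1)) (ren_tm \<sigma> (Neu H' S2))"
| eq_unfold_left:
    "\<lbrakk> Rec_decl r A M \<in> set \<Sigma>; prepat S1; contra M; reduce (erase A) S1 M = Some N;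
       eq_tm \<Sigma> ((n, Neu (Rec r) S1, Neu H S2) # \<Delta>) n N (Neu H S2) \<rbrakk>
     \<Longrightarrow> eq_tm \<Sigma> \<Delta> n (Neu (Rec r) S1) (Neu H S2)"
| eq_unfold_right:
    "\<lbrakk> Rec_decl r A M \<in> set \<Sigma>; prepat S2; contra M; \<forall>r'. H \<noteq> Rec r';
       reduce (erase A) S2 M = Some N;
       eq_tm \<Sigma> ((n, Neu H S1, Neu (Rec r) S2) # \<Delta>) n (Neu H S1) N \<rbrakk>
     \<Longrightarrow> eq_tm \<Sigma> \<Delta> n (Neu H S1) (Neu (Rec r) S2)"
| eq_con: "eq_spine \<Sigma> \<Delta> n S S' \<Longrightarrow> eq_tm \<Sigma> \<Delta> n (Neu (Con c) S) (Neu (Con c) S')"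
| eq_var: "eq_spine \<Sigma> \<Delta> n S S' \<Longrightarrow> eq_tm \<Sigma> \<Delta> n (Neu (Var y) S) (Neu (Var y) S')"
| eq_lam: "eq_tm \<Sigma> \<Delta> (Suc n) M M' \<Longrightarrow> eq_tm \<Sigma> \<Delta> n (Lam M) (Lam M')"
| eq_nil: "eq_spine \<Sigma> \<Delta> n Nil_sp Nil_sp"
| eq_arg:
    "\<lbrakk> eq_tm \<Sigma> \<Delta> n M M'; eq_spine \<Sigma> \<Delta> n S S' \<rbrakk>
     \<Longrightarrow> eq_spine \<Sigma> \<Delta> n (Arg M S) (Arg M' S')"
| eq_parg: "eq_spine \<Sigma> \<Delta> n S S' \<Longrightarrow> eq_spine \<Sigma> \<Delta> n (PArg x S) (PArg x S')"

subsection \<open>Boehm trees and expansion\<close>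

datatype bhead = BVar nat | BCon name

datatype 'a barg = BArg 'a | BPArg nat

codatatype btree = BBot | BLam btree | BNeu bhead "btree barg list"

text \<open>
  \<open>approx \<Sigma> k M B\<close> means that \<open>exp\<^bsup>[k]\<^esup>(M)\<close> is defined and equal to \<open>B\<close>.
  Expansion is componentwise on spines at every level, including level 0.
\<close>

inductive
  approx :: "signature \<Rightarrow> nat \<Rightarrow> tm \<Rightarrow> btree \<Rightarrow> bool" and
  approx_spine :: "signature \<Rightarrow> nat \<Rightarrow> spine \<Rightarrow> btree barg list \<Rightarrow> bool"
  for \<Sigma> :: signature where
  approx_0: "approx \<Sigma> 0 M BBot"
| approx_lam: "approx \<Sigma> (Suc k) M B \<Longrightarrow> approx \<Sigma> (Suc k) (Lam M) (BLam B)"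
| approx_con:
    "approx_spine \<Sigma> k S Bs \<Longrightarrow> approx \<Sigma> (Suc k) (Neu (Con c) S) (BNeu (BCon c) Bs)"
| approx_var:
    "approx_spine \<Sigma> k S Bs \<Longrightarrow> approx \<Sigma> (Suc k) (Neu (Var x) S) (BNeu (BVar x) Bs)"
| approx_rec:
    "\<lbrakk> Rec_decl r A M \<in> set \<Sigma>; prepat S; reduce (erase A) S M = Some N; approx \<Sigma> (Suc k) N B \<rbrakk>
     \<Longrightarrow> approx \<Sigma> (Suc k) (Neu (Rec r) S) B"
| approx_nil: "approx_spine \<Sigma> k Nil_sp []"
| approx_arg:
    "\<lbrakk> approx \<Sigma> k M B; approx_spine \<Sigma> k S Bs \<rbrakk>
     \<Longrightarrow> approx_spine \<Sigma> k (Arg M S) (BArg B # Bs)"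
| approx_parg:
    "approx_spine \<Sigma> k S Bs \<Longrightarrow> approx_spine \<Sigma> k (PArg x S) (BPArg x # Bs)"

text \<open>
  Limits are taken in the usual tree topology.  Every constructor counts for the depth here,
  including \<open>BLam\<close>, because a tree may begin with infinitely many abstractions.
\<close>

primrec truncate :: "nat \<Rightarrow> btree \<Rightarrow> btree" where
  "truncate 0 t = BBot"
| "truncate (Suc d) t =
     (case t of
        BBot \<Rightarrow> BBot
      | BLam u \<Rightarrow> BLam (truncate d u)
      | BNeu h us \<Rightarrow> BNeu h (map (map_barg (truncate d)) us))"

definition tree_limit :: "(nat \<Rightarrow> btree) \<Rightarrow> btree \<Rightarrow> bool" where
  "tree_limit X B \<longleftrightarrow> (\<forall>d. \<forall>\<^sub>F k in sequentially. truncate d (X k) = truncate d B)"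

definition is_expansion :: "signature \<Rightarrow> tm \<Rightarrow> btree \<Rightarrow> bool" where
  "is_expansion \<Sigma> M B \<longleftrightarrow> (\<exists>X. (\<forall>k. approx \<Sigma> k M (X k)) \<and> tree_limit X B)"

text \<open>\<open>expansion \<Sigma> M\<close> is \<open>None\<close> if some finite approximation of \<open>M\<close> is undefined.\<close>

definition expansion :: "signature \<Rightarrow> tm \<Rightarrow> btree option" where
  "expansion \<Sigma> M =
     (if \<forall>k. \<exists>B. approx \<Sigma> k M B then Some (THE B. is_expansion \<Sigma> M B) else None)"

text \<open>
  Over a CoLF signature the definite description in \<open>expansion\<close> denotes: the finite
  approximations, as soon as they are all defined, have exactly one limit.
\<close>

lemma truncate_inject: "\<forall>d. truncate d s = truncate d t \<Longrightarrow> s = t"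
proof (coinduction arbitrary: s t rule: btree.coinduct_strong)
  case Eq_btree
  then have eq: "truncate d s = truncate d t" for d by blast
  show ?case
  proof (cases s)
    case BBot
    with eq[of 1] show ?thesis by (cases t) auto
  next
    case (BLam u)
    with eq[of 1] obtain v where t: "t = BLam v" by (cases t) auto
    have "truncate d u = truncate d v" for d
      using eq[of "Suc d"] BLam t by simp
    then show ?thesis using BLam t by auto
  next
    case (BNeu h us)
    with eq[of 1] obtain vs where t: "t = BNeu h vs" by (cases t) auto
    have m: "map (map_barg (truncate d)) us = map (map_barg (truncate d)) vs" for d
      using eq[of "Suc d"] BNeu t by simp
    then have len: "length us = length vs" using map_eq_imp_length_eq by blast
    have "rel_barg (\<lambda>s t. \<forall>d. truncate d s = truncate d t) (us ! i) (vs ! i)"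
      if i: "i < length us" for i
    proof -
      have "map_barg (truncate d) (us ! i) = map_barg (truncate d) (vs ! i)" for d
        using arg_cong[OF m, of "\<lambda>xs. xs ! i"] i len by simp
      then show ?thesis by (cases "us ! i"; cases "vs ! i") auto
    qed
    then have "list_all2 (rel_barg (\<lambda>s t. \<forall>d. truncate d s = truncate d t)) us vs"
      using len by (simp add: list_all2_conv_all_nth)
    then have "list_all2 (rel_barg (\<lambda>s t. (\<exists>s' t'. s = s' \<and> t = t' \<and>
        (\<forall>d. truncate d s' = truncate d t')) \<or> s = t)) us vs"
      by (rule list_all2_mono) (auto elim!: barg.rel_mono_strong)
    then show ?thesis using BNeu t by simp
  qed
qed

lemma rec_decl_unique:
  assumes "distinct (map decl_name \<Sigma>)"
    and "Rec_decl r A M \<in> set \<Sigma>" and "Rec_decl r A' M' \<in> set \<Sigma>"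
  shows "A = A' \<and> M = M'"
  using inj_onD[of decl_name "set \<Sigma>" "Rec_decl r A M" "Rec_decl r A' M'"] assms
  by (auto simp: distinct_map)

inductive_cases approx_lamE: "approx \<Sigma> (Suc k) (Lam M) B"
inductive_cases approx_conE: "approx \<Sigma> (Suc k) (Neu (Con c) S) B"
inductive_cases approx_varE: "approx \<Sigma> (Suc k) (Neu (Var c) S) B"
inductive_cases approx_recE: "approx \<Sigma> (Suc k) (Neu (Rec c) S) B"
inductive_cases approx_nilE: "approx_spine \<Sigma> k Nil_sp Bs"
inductive_cases approx_argE: "approx_spine \<Sigma> k (Arg M S) Bs"
inductive_cases approx_pargE: "approx_spine \<Sigma> k (PArg x S) Bs"

lemma approx_coherent:
  assumes dist: "distinct (map decl_name \<Sigma>)"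
  shows "approx \<Sigma> k M B \<Longrightarrow>
      approx \<Sigma> l M B' \<Longrightarrow> d \<le> k \<Longrightarrow> d \<le> l \<Longrightarrow> truncate d B = truncate d B'"
    and "approx_spine \<Sigma> k S Bs \<Longrightarrow>
      approx_spine \<Sigma> l S Bs' \<Longrightarrow> d \<le> k \<Longrightarrow> d \<le> l \<Longrightarrow>
      map (map_barg (truncate d)) Bs = map (map_barg (truncate d)) Bs'"
proof (induction arbitrary: l B' d and l Bs' d rule: approx_approx_spine.inducts)
  case (approx_0 M)
  then show ?case by simp
next
  case (approx_lam k M B)
  show ?case
  proof (cases d)
    case (Suc d')
    with approx_lam.prems obtain l' where l: "l = Suc l'" by (cases l) auto
    with approx_lam.prems obtain C where C: "B' = BLam C" "approx \<Sigma> l M C"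
      by (auto elim: approx_lamE)
    have "truncate d' B = truncate d' C"
      using approx_lam.prems Suc by (intro approx_lam.IH(2)[OF C(2)]) auto
    then show ?thesis using C Suc by simp
  qed simp
next
  case (approx_con k S Bs c)
  show ?case
  proof (cases d)
    case (Suc d')
    with approx_con.prems obtain l' where l: "l = Suc l'" by (cases l) auto
    with approx_con.prems obtain Cs where C: "B' = BNeu (BCon c) Cs" "approx_spine \<Sigma> l' S Cs"
      by (auto elim: approx_conE)
    have "map (map_barg (truncate d')) Bs = map (map_barg (truncate d')) Cs"
      using approx_con.prems Suc l by (intro approx_con.IH(2)[OF C(2)]) auto
    then show ?thesis using C Suc by simp
  qed simp
next
  case (approx_var k S Bs x)
  show ?case
  proof (cases d)
    case (Suc d')
    with approx_var.prems obtain l' where l: "l = Suc l'" by (cases l) auto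
    with approx_var.prems obtain Cs where C: "B' = BNeu (BVar x) Cs" "approx_spine \<Sigma> l' S Cs"
      by (auto elim: approx_varE)
    have "map (map_barg (truncate d')) Bs = map (map_barg (truncate d')) Cs"
      using approx_var.prems Suc l by (intro approx_var.IH(2)[OF C(2)]) auto
    then show ?thesis using C Suc by simp
  qed simp
next
  case (approx_rec r A M S N k B)
  show ?case
  proof (cases d)
    case (Suc d')
    with approx_rec.prems obtain l' where l: "l = Suc l'" by (cases l) auto
    with approx_rec.prems obtain A' M' N' where
      "Rec_decl r A' M' \<in> set \<Sigma>" "reduce (erase A') S M' = Some N'" "approx \<Sigma> l N' B'"
      by (auto elim: approx_recE)
    with rec_decl_unique[OF dist \<open>Rec_decl r A M \<in> set \<Sigma>\<close>] \<open>reduce (erase A) S M = Some N\<close>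
    have "approx \<Sigma> l N B'" by auto
    then show ?thesis using approx_rec.IH approx_rec.prems by blast
  qed simp
next
  case (approx_nil k)
  then show ?case by (auto elim: approx_nilE)
next
  case (approx_arg k M B S Bs)
  from approx_arg.prems(1) obtain C Cs where
    C: "Bs' = BArg C # Cs" "approx \<Sigma> l M C" "approx_spine \<Sigma> l S Cs"
    by (auto elim: approx_argE)
  then show ?case using approx_arg.IH approx_arg.prems by simp
next
  case (approx_parg k S Bs x)
  from approx_parg.prems(1) obtain Cs where
    C: "Bs' = BPArg x # Cs" "approx_spine \<Sigma> l S Cs"
    by (auto elim: approx_pargE)
  then show ?case using approx_parg.IH approx_parg.prems by simp
qed

fun lam_body :: "btree \<Rightarrow> btree" where
  "lam_body (BLam u) = u"
| "lam_body t = BBot"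

fun neu_args :: "btree \<Rightarrow> btree barg list" where
  "neu_args (BNeu h us) = us"
| "neu_args t = []"

fun the_barg :: "btree barg \<Rightarrow> btree" where
  "the_barg (BArg u) = u"
| "the_barg (BPArg x) = BBot"

definition arg_seqs :: "(nat \<Rightarrow> btree) \<Rightarrow> btree barg list \<Rightarrow> (nat \<Rightarrow> btree) barg list" where
  "arg_seqs X us =
     map (\<lambda>i. map_barg (\<lambda>_ k. the_barg (neu_args (X (Suc k)) ! i)) (us ! i)) [0..<length us]"

primcorec seq_limit :: "(nat \<Rightarrow> btree) \<Rightarrow> btree" where
  "seq_limit X =
     (case X 1 of
        BBot \<Rightarrow> BBot
      | BLam u \<Rightarrow> BLam (seq_limit (\<lambda>k. lam_body (X (Suc k))))
      | BNeu h us \<Rightarrow> BNeu h (map (map_barg seq_limit) (arg_seqs X us)))"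

definition coherent :: "(nat \<Rightarrow> btree) \<Rightarrow> bool" where
  "coherent X \<longleftrightarrow> (\<forall>d k l. d \<le> k \<longrightarrow> d \<le> l \<longrightarrow> truncate d (X k) = truncate d (X l))"

lemma truncate_seq_limit:
  "coherent X \<Longrightarrow> d \<le> k \<Longrightarrow> truncate d (X k) = truncate d (seq_limit X)"
proof (induction d arbitrary: X k)
  case (Suc d)
  then obtain k' where k: "k = Suc k'" "d \<le> k'" by (cases k) auto
  have coh: "truncate e (X i) = truncate e (X j)" if "e \<le> i" "e \<le> j" for e i j
    using Suc.prems(1) that unfolding coherent_def by blast
  have t1: "truncate 1 (X 1) = truncate 1 (X (Suc j))" for j by (rule coh) auto
  show ?case
  proof (cases "X 1")
    case BBot
    have "X k = BBot" using t1[of k'] BBot k by (cases "X k") auto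
    also have "\<dots> = seq_limit X" using BBot by (subst seq_limit.code) simp
    finally show ?thesis by (rule arg_cong)
  next
    case (BLam u)
    let ?Y = "\<lambda>k. lam_body (X (Suc k))"
    have X: "X (Suc j) = BLam (?Y j)" for j using t1[of j] BLam by (cases "X (Suc j)") auto
    have "coherent ?Y"
      unfolding coherent_def
    proof (intro allI impI)
      fix e i j :: nat
      assume "e \<le> i" "e \<le> j"
      then have "truncate (Suc e) (X (Suc i)) = truncate (Suc e) (X (Suc j))" by (intro coh) auto
      then show "truncate e (?Y i) = truncate e (?Y j)"
        by (subst (asm) X[of i], subst (asm) X[of j]) simp
    qed
    from Suc.IH[OF this k(2)] have "truncate d (?Y k') = truncate d (seq_limit ?Y)" .
    moreover have "seq_limit X = BLam (seq_limit ?Y)" using BLam by (subst seq_limit.code) simp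
    ultimately show ?thesis unfolding k(1) by (subst X[of k']) simp
  next
    case (BNeu h us)
    let ?as = "\<lambda>j. neu_args (X (Suc j))"
    have X: "X (Suc j) = BNeu h (?as j)" for j
      using t1[of j] BNeu by (cases "X (Suc j)") auto
    have m0: "map (map_barg (truncate 0)) us = map (map_barg (truncate 0)) (?as j)" for j
      using t1[of j] BNeu by (cases "X (Suc j)") auto
    have len: "length (?as j) = length us" for j
      using arg_cong[OF m0[of j], of length] by simp
    have nth0: "map_barg (truncate 0) (us ! i) = map_barg (truncate 0) (?as j ! i)"
      if "i < length us" for i j
      using arg_cong[OF m0[of j], of "\<lambda>xs. xs ! i"] that len[of j] by simp
    have "map_barg (truncate d) (?as k' ! i) = map_barg (truncate d)
        (map_barg seq_limit (map_barg (\<lambda>_ k. the_barg (?as k ! i)) (us ! i)))"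
      if i: "i < length us" for i
    proof (cases "us ! i")
      case (BPArg x)
      then show ?thesis using nth0[OF i, of k'] by (cases "?as k' ! i") auto
    next
      case (BArg u)
      let ?Y = "\<lambda>k. the_barg (?as k ! i)"
      have Y: "?as j ! i = BArg (?Y j)" for j using nth0[OF i, of j] BArg
        by (cases "?as j ! i") auto
      have "coherent ?Y"
        unfolding coherent_def
      proof (intro allI impI)
        fix e j j' :: nat
        assume "e \<le> j" "e \<le> j'"
        then have "truncate (Suc e) (X (Suc j)) = truncate (Suc e) (X (Suc j'))"
          by (intro coh) auto
        then have "map (map_barg (truncate e)) (?as j) = map (map_barg (truncate e)) (?as j')"
          by (subst (asm) X[of j], subst (asm) X[of j']) simp
        from arg_cong[OF this, of "\<lambda>xs. xs ! i"]
        have "map_barg (truncate e) (?as j ! i) = map_barg (truncate e) (?as j' ! i)"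
          using i len by simp
        then show "truncate e (?Y j) = truncate e (?Y j')"
          by (subst (asm) Y[of j], subst (asm) Y[of j']) simp
      qed
      from Suc.IH[OF this k(2)] show ?thesis using BArg
        by (subst Y[of k']) simp
    qed
    then have "map (map_barg (truncate d)) (?as k') =
        map (map_barg (truncate d)) (map (map_barg seq_limit) (arg_seqs X us))"
      using len[of k'] by (intro nth_equalityI) (auto simp: arg_seqs_def)
    moreover have "seq_limit X = BNeu h (map (map_barg seq_limit) (arg_seqs X us))"
      using BNeu by (subst seq_limit.code) simp
    ultimately show ?thesis unfolding k(1) by (subst X[of k']) simp
  qed
qed simp

lemma ex1_is_expansion:
  assumes "colf_signature \<Sigma>" and "\<forall>k. \<exists>B. approx \<Sigma> k M B"
  shows "\<exists>!B. is_expansion \<Sigma> M B"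
proof -
  have dist: "distinct (map decl_name \<Sigma>)" using assms(1) by (simp add: colf_signature_def)
  obtain X where X: "approx \<Sigma> k M (X k)" for k using assms(2) by metis
  have "coherent X" unfolding coherent_def using approx_coherent(1)[OF dist X X] by blast
  then have lim: "\<forall>\<^sub>F k in sequentially. truncate d (X k) = truncate d (seq_limit X)" for d
    unfolding eventually_sequentially using truncate_seq_limit by blast
  then have ex: "is_expansion \<Sigma> M (seq_limit X)"
    using X unfolding is_expansion_def tree_limit_def by blast
  show ?thesis
  proof (rule ex1I[of "is_expansion \<Sigma> M", OF ex])
    fix B
    assume "is_expansion \<Sigma> M B"
    then obtain Y where Y: "\<And>k. approx \<Sigma> k M (Y k)"
      and B: "\<And>d. \<forall>\<^sub>F k in sequentially. truncate d (Y k) = truncate d B"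
      unfolding is_expansion_def tree_limit_def by blast
    show "B = seq_limit X"
    proof (rule truncate_inject, rule allI)
      fix d
      have "\<forall>\<^sub>F k in sequentially. truncate d (X k) = truncate d (Y k)"
        unfolding eventually_sequentially using approx_coherent(1)[OF dist X Y] by blast
      with B[of d] lim[of d] have "\<forall>\<^sub>F k in sequentially. truncate d B = truncate d (seq_limit X)"
        by eventually_elim simp
      then show "truncate d B = truncate d (seq_limit X)" by simp
    qed
  qed
qed

lemma expansion_eq_Some_iff:
  assumes "colf_signature \<Sigma>"
  shows "expansion \<Sigma> M = Some B \<longleftrightarrow> is_expansion \<Sigma> M B"
proof (cases "\<forall>k. \<exists>B. approx \<Sigma> k M B")
  case True
  from ex1_is_expansion[OF assms True] show ?thesis
    unfolding expansion_def using True by (auto intro: theI' simp: the1_equality)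
next
  case False
  then show ?thesis unfolding expansion_def is_expansion_def by auto
qed

end

theory Submission
  imports Defs
begin

text \<open>
  Only prepattern spines are ever reduced, so every term met while comparing \<open>M\<close> and \<open>M'\<close> is a
  renaming of one of finitely many subterms of \<open>M\<close>, \<open>M'\<close> and the bodies of \<open>\<Sigma>\<close>.  A pair of such
  terms is determined, up to a common renaming, by the two subterms and by which of their free
  variables have been identified; this leaves finitely many possibilities.  Hence on every branch
  either an assumption applies or an unfolding uses up a new possibility, while all other steps
  decrease the size of the terms.  As the expansions agree, some rule always applies.
\<close>

subsection \<open>Renamings\<close>

lemma spine_arg_induct [case_names Nil_sp Arg PArg]:
  assumes "P Nil_sp" "\<And>M S. P S \<Longrightarrow> P (Arg M S)" "\<And>x S. P S \<Longrightarrow> P (PArg x S)"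
  shows "P S"
  using assms by (induction S rule: spine.induct[where ?P1.0 = "\<lambda>_. True"]) auto

lemma lift_simps [simp]: "lift \<sigma> 0 = 0" "lift \<sigma> (Suc i) = Suc (\<sigma> i)"
  by (simp_all add: lift_def)

lemma lift_comp: "lift \<rho> \<circ> lift \<sigma> = lift (\<rho> \<circ> \<sigma>)"
  by (rule ext) (simp add: lift_def split: nat.split)

lemma lift_id: "lift id = id"
  by (rule ext) (simp add: lift_def split: nat.split)

lemma ren_head_comp: "ren_head \<rho> (ren_head \<sigma> H) = ren_head (\<rho> \<circ> \<sigma>) H"
  by (cases H) auto

lemma ren_comp:
  "ren_tm \<rho> (ren_tm \<sigma> M) = ren_tm (\<rho> \<circ> \<sigma>) M"
  "ren_spine \<rho> (ren_spine \<sigma> S) = ren_spine (\<rho> \<circ> \<sigma>) S"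
  by (induction M and S arbitrary: \<rho> \<sigma> and \<rho> \<sigma>) (auto simp: ren_head_comp lift_comp)

lemma ren_head_id: "ren_head id H = H"
  by (cases H) auto

lemma ren_id: "ren_tm id M = M" "ren_spine id S = S"
  by (induction M and S) (simp_all add: ren_head_id lift_id del: id_apply, simp_all)

lemma ren_head_cong: "scoped_head k H \<Longrightarrow> \<forall>i<k. \<sigma> i = \<rho> i \<Longrightarrow> ren_head \<sigma> H = ren_head \<rho> H"
  by (cases H) auto

lemma ren_cong:
  "scoped_tm k M \<Longrightarrow> \<forall>i<k. \<sigma> i = \<rho> i \<Longrightarrow> ren_tm \<sigma> M = ren_tm \<rho> M"
  "scoped_spine k S \<Longrightarrow> \<forall>i<k. \<sigma> i = \<rho> i \<Longrightarrow> ren_spine \<sigma> S = ren_spine \<rho> S"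
proof (induction M and S arbitrary: k \<sigma> \<rho> and k \<sigma> \<rho>)
  case (Lam M)
  have "\<forall>i<Suc k. lift \<sigma> i = lift \<rho> i"
    using Lam.prems by (auto simp: lift_def split: nat.split)
  with Lam show ?case by auto
qed (auto simp: ren_head_cong)

lemma scoped_ren_spine:
  assumes "scoped_spine k S" "prepat S" "\<forall>i<k. \<sigma> i < n"
  shows "scoped_spine n (ren_spine \<sigma> S)"
  using assms by (induction S rule: spine_arg_induct) auto

lemma prepat_ren_spine [simp]: "prepat (ren_spine \<sigma> S) \<longleftrightarrow> prepat S"
  by (induction S rule: spine_arg_induct) auto

lemma contra_ren_tm [simp]: "contra (ren_tm \<sigma> M) \<longleftrightarrow> contra M"
proof (induction M arbitrary: \<sigma> rule: contra.induct)
  case (1 H S)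
  then show ?case by (cases H) auto
qed auto

lemma ren_tm_eq_Lam: "ren_tm \<sigma> P = Lam M \<longleftrightarrow> (\<exists>Q. P = Lam Q \<and> M = ren_tm (lift \<sigma>) Q)"
  by (cases P) auto

lemma ren_tm_eq_Neu:
  "ren_tm \<sigma> P = Neu H S \<longleftrightarrow> (\<exists>G T. P = Neu G T \<and> H = ren_head \<sigma> G \<and> S = ren_spine \<sigma> T)"
  by (cases P) auto

primrec args :: "spine \<Rightarrow> tm set" where
  "args Nil_sp = {}"
| "args (Arg M S) = insert M (args S)"
| "args (PArg x S) = args S"

lemma args_ren_spine [simp]: "args (ren_spine \<sigma> S) = ren_tm \<sigma> ` args S"
  by (induction S rule: spine_arg_induct) auto

lemma size_args: "M \<in> args S \<Longrightarrow> size M < size S"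
  by (induction S rule: spine_arg_induct) auto

subsection \<open>Terms with equal expansions\<close>

text \<open>A finitary form of equality of Boehm trees that components inherit. Levels are only
  bounded below by \<open>d\<close> because passing under an abstraction lowers the depth of
  truncation but not the level of expansion.\<close>

definition agree :: "signature \<Rightarrow> tm \<Rightarrow> tm \<Rightarrow> bool" where
  "agree \<Sigma> M M' \<longleftrightarrow> (\<forall>d. \<exists>k\<ge>d. \<exists>l\<ge>d. \<exists>B B'. approx \<Sigma> k M B \<and> approx \<Sigma> l M' B' \<and>
     truncate d B = truncate d B')"

definition agree_spine :: "signature \<Rightarrow> spine \<Rightarrow> spine \<Rightarrow> bool" where
  "agree_spine \<Sigma> S S' \<longleftrightarrow> (\<forall>d. \<exists>k\<ge>d. \<exists>l\<ge>d. \<exists>Bs Bs'. approx_spine \<Sigma> k S Bs \<and>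
     approx_spine \<Sigma> l S' Bs' \<and> map (map_barg (truncate d)) Bs = map (map_barg (truncate d)) Bs')"

text \<open>Positive levels and depths make the outermost constructor visible; at level 0 every term
  is approximated by \<open>BBot\<close>.\<close>

lemma agree_SucE:
  assumes "agree \<Sigma> M M'"
  obtains k l B B' where "d \<le> k" "d \<le> l" "approx \<Sigma> (Suc k) M B" "approx \<Sigma> (Suc l) M' B'"
    "truncate (Suc d) B = truncate (Suc d) B'"
proof -
  from assms obtain k l B B' where "Suc d \<le> k" "Suc d \<le> l" "approx \<Sigma> k M B" "approx \<Sigma> l M' B'"
    "truncate (Suc d) B = truncate (Suc d) B'"
    unfolding agree_def by blast
  then show thesis by (cases k; cases l) (auto intro: that)
qed

lemma agree_spineE:
  assumes "agree_spine \<Sigma> S S'"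
  obtains k l Bs Bs' where "d \<le> k" "d \<le> l" "approx_spine \<Sigma> k S Bs" "approx_spine \<Sigma> l S' Bs'"
    "map (map_barg (truncate d)) Bs = map (map_barg (truncate d)) Bs'"
  using assms unfolding agree_spine_def by blast

lemma agree_sym: "agree \<Sigma> M M' \<Longrightarrow> agree \<Sigma> M' M"
  unfolding agree_def by metis

lemma agree_if_expansion_eq:
  assumes "is_expansion \<Sigma> M B" "is_expansion \<Sigma> M' B"
  shows "agree \<Sigma> M M'"
  unfolding agree_def
proof
  fix d
  obtain X Y where X: "\<And>k. approx \<Sigma> k M (X k)" and Y: "\<And>k. approx \<Sigma> k M' (Y k)"
    and "\<forall>\<^sub>F k in sequentially. truncate d (X k) = truncate d B"
    and "\<forall>\<^sub>F k in sequentially. truncate d (Y k) = truncate d B"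
    using assms unfolding is_expansion_def tree_limit_def by blast
  then obtain a b where "\<And>k. k \<ge> a \<Longrightarrow> truncate d (X k) = truncate d B"
    and "\<And>k. k \<ge> b \<Longrightarrow> truncate d (Y k) = truncate d B"
    unfolding eventually_sequentially by blast
  then have "truncate d (X (max a d)) = truncate d (Y (max b d))" by simp
  with X Y show "\<exists>k\<ge>d. \<exists>l\<ge>d. \<exists>B B'. approx \<Sigma> k M B \<and> approx \<Sigma> l M' B' \<and>
      truncate d B = truncate d B'"
    by (meson max.cobounded2)
qed

section \<open>Inversion of agreement\<close>

lemma agree_Lam:
  assumes "agree \<Sigma> (Lam M) (Lam M')"
  shows "agree \<Sigma> M M'"
  unfolding agree_def
proof
  fix d
  from assms obtain k l B B' where *: "d \<le> k" "d \<le> l" "approx \<Sigma> (Suc k) (Lam M) B"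
    "approx \<Sigma> (Suc l) (Lam M') B'" "truncate (Suc d) B = truncate (Suc d) B'"
    by (rule agree_SucE)
  then obtain C C' where "B = BLam C" "approx \<Sigma> (Suc k) M C" "B' = BLam C'" "approx \<Sigma> (Suc l) M' C'"
    by (auto elim!: approx_lamE)
  with * show "\<exists>k\<ge>d. \<exists>l\<ge>d. \<exists>B B'. approx \<Sigma> k M B \<and> approx \<Sigma> l M' B' \<and>
      truncate d B = truncate d B'"
    by (metis btree.inject(1) btree.simps(10) le_SucI truncate.simps(2))
qed

fun bhead_of :: "head \<Rightarrow> bhead" where
  "bhead_of (Var x) = BVar x"
| "bhead_of (Con c) = BCon c"
| "bhead_of (Rec r) = undefined"

lemma approx_NeuE:
  assumes "approx \<Sigma> (Suc k) (Neu H S) B" "contra (Neu H S)"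
  obtains Bs where "B = BNeu (bhead_of H) Bs" "approx_spine \<Sigma> k S Bs"
  using assms by (cases H) (auto elim: approx_conE approx_varE)

lemma bhead_of_eq: "bhead_of H = bhead_of H' \<Longrightarrow> contra (Neu H S) \<Longrightarrow> contra (Neu H' S') \<Longrightarrow> H = H'"
  by (cases H; cases H') auto

lemma agree_Neu:
  assumes "agree \<Sigma> (Neu H S) (Neu H' S')" "contra (Neu H S)" "contra (Neu H' S')"
  shows "H = H' \<and> agree_spine \<Sigma> S S'"
proof -
  have *: "H = H' \<and> (\<exists>k\<ge>d. \<exists>l\<ge>d. \<exists>Bs Bs'. approx_spine \<Sigma> k S Bs \<and> approx_spine \<Sigma> l S' Bs' \<and>
      map (map_barg (truncate d)) Bs = map (map_barg (truncate d)) Bs')" for d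
  proof -
    from assms(1) obtain k l B B' where *: "d \<le> k" "d \<le> l" "approx \<Sigma> (Suc k) (Neu H S) B"
      "approx \<Sigma> (Suc l) (Neu H' S') B'" "truncate (Suc d) B = truncate (Suc d) B'"
      by (rule agree_SucE)
    from approx_NeuE[OF *(3) assms(2)] obtain Bs where
      1: "B = BNeu (bhead_of H) Bs" "approx_spine \<Sigma> k S Bs" .
    from approx_NeuE[OF *(4) assms(3)] obtain Bs' where
      2: "B' = BNeu (bhead_of H') Bs'" "approx_spine \<Sigma> l S' Bs'" .
    from *(5) 1 2 have "bhead_of H = bhead_of H'"
      "map (map_barg (truncate d)) Bs = map (map_barg (truncate d)) Bs'" by auto
    with * 1 2 bhead_of_eq assms(2,3) show ?thesis by blast
  qed
  then show ?thesis unfolding agree_spine_def by blast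
qed

lemma not_agree_Lam_Neu:
  assumes "agree \<Sigma> (Lam M) (Neu H S)" "contra (Neu H S)"
  shows False
proof -
  from assms(1) obtain k l B B' where *: "approx \<Sigma> (Suc k) (Lam M) B"
    "approx \<Sigma> (Suc l) (Neu H S) B'" "truncate (Suc 0) B = truncate (Suc 0) B'"
    by (rule agree_SucE)
  from *(1) obtain C where "B = BLam C" by (auto elim: approx_lamE)
  moreover from approx_NeuE[OF *(2) assms(2)] obtain Bs where "B' = BNeu (bhead_of H) Bs" .
  ultimately show False using *(3) by simp
qed

text \<open>Unfolding costs no level, so at positive levels each approximation of the redex is one
  of its reduct.\<close>

lemma agree_Rec:
  assumes "distinct (map decl_name \<Sigma>)" "agree \<Sigma> (Neu (Rec r) S) M'"
  obtains A M N where "Rec_decl r A M \<in> set \<Sigma>" "prepat S" "reduce (erase A) S M = Some N"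
    "agree \<Sigma> N M'"
proof -
  have inv: "\<exists>A M N. Rec_decl r A M \<in> set \<Sigma> \<and> prepat S \<and> reduce (erase A) S M = Some N \<and>
      approx \<Sigma> (Suc k) N B" if "approx \<Sigma> (Suc k) (Neu (Rec r) S) B" for k B
    using that by (rule approx_recE) blast
  from assms(2) obtain k B where "approx \<Sigma> (Suc k) (Neu (Rec r) S) B" by (rule agree_SucE)
  then obtain A M N where 1: "Rec_decl r A M \<in> set \<Sigma>" "prepat S" "reduce (erase A) S M = Some N"
    using inv by blast
  \<comment> \<open>Each level might use its own declaration; uniqueness makes all of them yield the
    same \<open>N\<close>.\<close>
  have "approx \<Sigma> (Suc k) N B" if "approx \<Sigma> (Suc k) (Neu (Rec r) S) B" for k B
    using inv[OF that] rec_decl_unique[OF assms(1) 1(1)] 1(3) by fastforce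
  then have 2: "approx \<Sigma> k N B" if "approx \<Sigma> k (Neu (Rec r) S) B" "k > 0" for k B
    using that by (cases k) auto
  have "agree \<Sigma> N M'"
    unfolding agree_def
  proof
    fix d
    show "\<exists>k\<ge>d. \<exists>l\<ge>d. \<exists>B B'. approx \<Sigma> k N B \<and> approx \<Sigma> l M' B' \<and> truncate d B = truncate d B'"
    proof (cases d)
      \<comment> \<open>Level 0 cannot be inverted through the unfolding rule, but at depth 0 the
        trivial approximations suffice.\<close>
      case 0
      then show ?thesis by (auto intro: approx_0)
    next
      case (Suc d')
      from assms(2) obtain k l B B' where "k \<ge> d" "l \<ge> d" "approx \<Sigma> k (Neu (Rec r) S) B"
        "approx \<Sigma> l M' B'" "truncate d B = truncate d B'"
        unfolding agree_def by blast
      moreover from this have "approx \<Sigma> k N B" using Suc by (intro 2) auto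
      ultimately show ?thesis by blast
    qed
  qed
  with 1 that show thesis by blast
qed

text \<open>Truncation acts inside the list entries, so even depth 0 preserves the length of a
  spine, the kind of each argument and the prepattern variables. This forces the shape of
  \<open>T\<close>, and the same levels serve the argument and the rest.\<close>

lemma agree_spine_ArgD:
  assumes "agree_spine \<Sigma> (Arg M S) T"
  shows "\<exists>M' S'. T = Arg M' S' \<and> agree \<Sigma> M M' \<and> agree_spine \<Sigma> S S'"
proof -
  have *: "\<exists>M' S'. T = Arg M' S' \<and> (\<exists>k\<ge>d. \<exists>l\<ge>d. \<exists>B B' Bs Bs'. approx \<Sigma> k M B \<and>
      approx \<Sigma> l M' B' \<and> truncate d B = truncate d B' \<and> approx_spine \<Sigma> k S Bs \<and>
      approx_spine \<Sigma> l S' Bs' \<and> map (map_barg (truncate d)) Bs = map (map_barg (truncate d)) Bs')"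
    for d
  proof -
    from assms obtain k l Bs Bs' where "d \<le> k" "d \<le> l" "approx_spine \<Sigma> k (Arg M S) Bs"
      "approx_spine \<Sigma> l T Bs'" "map (map_barg (truncate d)) Bs = map (map_barg (truncate d)) Bs'"
      by (rule agree_spineE)
    then show ?thesis
      by (cases T) (fastforce elim!: approx_nilE approx_argE approx_pargE)+
  qed
  then obtain M' S' where "T = Arg M' S'" by blast
  with * show ?thesis unfolding agree_def agree_spine_def
    by (simp only: spine.inject) meson
qed

lemma agree_spine_PArgD:
  assumes "agree_spine \<Sigma> (PArg x S) T"
  shows "\<exists>S'. T = PArg x S' \<and> agree_spine \<Sigma> S S'"
proof -
  have *: "\<exists>S'. T = PArg x S' \<and> (\<exists>k\<ge>d. \<exists>l\<ge>d. \<exists>Bs Bs'. approx_spine \<Sigma> k S Bs \<and>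
      approx_spine \<Sigma> l S' Bs' \<and> map (map_barg (truncate d)) Bs = map (map_barg (truncate d)) Bs')"
    for d
  proof -
    from assms obtain k l Bs Bs' where "d \<le> k" "d \<le> l" "approx_spine \<Sigma> k (PArg x S) Bs"
      "approx_spine \<Sigma> l T Bs'" "map (map_barg (truncate d)) Bs = map (map_barg (truncate d)) Bs'"
      by (rule agree_spineE)
    then show ?thesis
      by (cases T) (fastforce elim!: approx_nilE approx_argE approx_pargE)+
  qed
  then show ?thesis unfolding agree_spine_def by blast
qed

lemma agree_spine_NilD:
  assumes "agree_spine \<Sigma> Nil_sp T"
  shows "T = Nil_sp"
proof -
  from assms obtain k l Bs Bs' where "approx_spine \<Sigma> k Nil_sp Bs" "approx_spine \<Sigma> l T Bs'"
    "map (map_barg (truncate 0)) Bs = map (map_barg (truncate 0)) Bs'"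
    by (rule agree_spineE)
  then show ?thesis by (cases T) (auto elim!: approx_nilE approx_argE approx_pargE)
qed

text \<open>Agreement itself pairs the arguments by position, so the second premise may range over
  all pairs of arguments; the main induction supplies it because arguments are smaller.\<close>

lemma eq_spine_if_agree:
  assumes "agree_spine \<Sigma> S S'"
    and "\<And>M M'. M \<in> args S \<Longrightarrow> M' \<in> args S' \<Longrightarrow> agree \<Sigma> M M' \<Longrightarrow> eq_tm \<Sigma> \<Delta> n M M'"
  shows "eq_spine \<Sigma> \<Delta> n S S'"
  using assms
proof (induction S arbitrary: S' rule: spine_arg_induct)
  case Nil_sp
  then show ?case using agree_spine_NilD eq_nil by blast
next
  case (Arg M S)
  from agree_spine_ArgD[OF Arg.prems(1)] obtain M' T where
    *: "S' = Arg M' T" "agree \<Sigma> M M'" "agree_spine \<Sigma> S T" by blast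
  then have "eq_spine \<Sigma> \<Delta> n S T" by (intro Arg.IH) (auto intro: Arg.prems(2))
  with * show ?case by (auto intro!: eq_arg Arg.prems(2))
next
  case (PArg x S)
  from agree_spine_PArgD[OF PArg.prems(1)] obtain T where
    *: "S' = PArg x T" "agree_spine \<Sigma> S T" by blast
  then have "eq_spine \<Sigma> \<Delta> n S T" by (intro PArg.IH) (auto intro: PArg.prems(2))
  with * show ?case by (auto intro!: eq_parg)
qed

subsection \<open>Subterms in their contexts\<close>

text \<open>Each subterm carries the length of its own context, the domain of the renamings later
  applied to it.\<close>

primrec subs_tm :: "tm \<Rightarrow> nat \<Rightarrow> (nat \<times> tm) set"
  and subs_spine :: "spine \<Rightarrow> nat \<Rightarrow> (nat \<times> tm) set" where
  "subs_tm (Neu H S) k = insert (k, Neu H S) (subs_spine S k)"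
| "subs_tm (Lam M) k = insert (k, Lam M) (subs_tm M (Suc k))"
| "subs_spine Nil_sp k = {}"
| "subs_spine (Arg M S) k = subs_tm M k \<union> subs_spine S k"
| "subs_spine (PArg x S) k = subs_spine S k"

lemma subs_refl: "(k, M) \<in> subs_tm M k"
  by (cases M) auto

lemma finite_subs: "finite (subs_tm M k)" "finite (subs_spine S k)"
  by (induction M and S arbitrary: k and k) auto

lemma scoped_subs:
  "scoped_tm k M \<Longrightarrow> (l, P) \<in> subs_tm M k \<Longrightarrow> scoped_tm l P"
  "scoped_spine k S \<Longrightarrow> (l, P) \<in> subs_spine S k \<Longrightarrow> scoped_tm l P"
  by (induction M and S arbitrary: k and k) auto

lemma subs_Lam:
  "(l, Lam P) \<in> subs_tm M k \<Longrightarrow> (Suc l, P) \<in> subs_tm M k"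
  "(l, Lam P) \<in> subs_spine S k \<Longrightarrow> (Suc l, P) \<in> subs_spine S k"
  by (induction M and S arbitrary: k and k) (auto simp: subs_refl)

lemma args_subs: "P \<in> args S \<Longrightarrow> (k, P) \<in> subs_spine S k"
  by (induction S rule: spine_arg_induct) (auto simp: subs_refl)

lemma subs_args:
  "(l, Neu H T) \<in> subs_tm M k \<Longrightarrow> P \<in> args T \<Longrightarrow> (l, P) \<in> subs_tm M k"
  "(l, Neu H T) \<in> subs_spine S k \<Longrightarrow> P \<in> args T \<Longrightarrow> (l, P) \<in> subs_spine S k"
  by (induction M and S arbitrary: k and k) (auto simp: args_subs)

subsection \<open>Pairs of renamed subterms\<close>

definition dom2 :: "nat \<Rightarrow> nat \<Rightarrow> (nat + nat) set" where
  "dom2 k l = {..<k} <+> {..<l}"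

text \<open>The equivalence relation on the disjoint union of the two contexts that records which
  variables \<open>\<sigma>\<close> and \<open>\<tau>\<close> jointly identify. Unlike the renamings
  themselves, it has finitely many values for fixed \<open>k\<close> and \<open>l\<close>, however
  large the target context grows.\<close>

definition kernel :: "nat \<Rightarrow> nat \<Rightarrow> (nat \<Rightarrow> nat) \<Rightarrow> (nat \<Rightarrow> nat) \<Rightarrow> ((nat + nat) \<times> (nat + nat)) set"
  where "kernel k l \<sigma> \<tau> =
    {(a, b) \<in> dom2 k l \<times> dom2 k l. case_sum \<sigma> \<tau> a = case_sum \<sigma> \<tau> b}"

text \<open>Maps with the same kernel differ by a map between their images, here a renaming that
  carries the first pair to the second.\<close>

lemma kernel_eq_factor:
  assumes "kernel k l \<sigma> \<tau> = kernel k l \<sigma>' \<tau>'"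
    and "\<forall>i<k. \<sigma>' i < n" "\<forall>i<l. \<tau>' i < n" "m \<le> n"
  obtains \<rho> where "\<forall>i<m. \<rho> i < n" "\<forall>i<k. \<rho> (\<sigma> i) = \<sigma>' i" "\<forall>i<l. \<rho> (\<tau> i) = \<tau>' i"
proof -
  let ?f = "case_sum \<sigma> \<tau>" and ?g = "case_sum \<sigma>' \<tau>'" and ?D = "dom2 k l"
  \<comment> \<open>On the joint image, take any preimage and apply the second pair; equality of
    kernels makes the choice immaterial. Off the image \<open>\<rho>\<close> is the identity, which
    maps indices below \<open>m\<close> below \<open>n\<close> because
    \<open>m \<le> n\<close>.\<close>
  define \<rho> where "\<rho> y = (if y \<in> ?f ` ?D then ?g (inv_into ?D ?f y) else y)" for y
  have g: "?g a < n" if "a \<in> ?D" for a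
    using that assms(2,3) by (auto simp: dom2_def)
  have "\<rho> (?f a) = ?g a" if a: "a \<in> ?D" for a
  proof -
    let ?b = "inv_into ?D ?f (?f a)"
    have "?b \<in> ?D" "?f ?b = ?f a"
      using a by (auto intro: inv_into_into f_inv_into_f)
    then have "(?b, a) \<in> kernel k l \<sigma> \<tau>" using a by (simp add: kernel_def)
    then have "?g ?b = ?g a" unfolding assms(1) by (simp add: kernel_def)
    then show ?thesis using a by (simp add: \<rho>_def)
  qed
  note fact = this
  have "\<forall>i<m. \<rho> i < n"
    using assms(4) g[OF inv_into_into[of _ ?f]] by (simp add: \<rho>_def)
  moreover have "\<forall>i<k. \<rho> (\<sigma> i) = \<sigma>' i"
    using fact[of "Inl i" for i] by (auto simp: dom2_def)
  moreover have "\<forall>i<l. \<rho> (\<tau> i) = \<tau>' i"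
    using fact[of "Inr i" for i] by (auto simp: dom2_def)
  ultimately show thesis using that by blast
qed

type_synonym pair_key = "(nat \<times> tm) \<times> (nat \<times> tm) \<times> ((nat + nat) \<times> (nat + nat)) set"

definition keys :: "(nat \<times> tm) set \<Rightarrow> pair_key set" where
  "keys U = (\<Union>p\<in>U. \<Union>q\<in>U. {p} \<times> {q} \<times> Pow (dom2 (fst p) (fst q) \<times> dom2 (fst p) (fst q)))"

lemma finite_keys: "finite U \<Longrightarrow> finite (keys U)"
  by (auto simp: keys_def dom2_def)

lemma kernel_in_keys: "(k, P) \<in> U \<Longrightarrow> (l, Q) \<in> U \<Longrightarrow> ((k, P), (l, Q), kernel k l \<sigma> \<tau>) \<in> keys U"
  by (force simp: keys_def kernel_def)

text \<open>There is an assumption about the same two subterms with the same identifications. The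
  bound \<open>m \<le> n\<close> is what \<open>kernel_eq_factor\<close> requires to rename that
  assumption into the present context.\<close>

fun recorded :: "assumption list \<Rightarrow> nat \<Rightarrow> pair_key \<Rightarrow> bool" where
  "recorded \<Delta> n ((k, P), (l, Q), R) \<longleftrightarrow>
    (\<exists>m \<sigma> \<tau>. m \<le> n \<and> (m, ren_tm \<sigma> P, ren_tm \<tau> Q) \<in> set \<Delta> \<and> kernel k l \<sigma> \<tau> = R)"

lemma recorded_mono: "recorded \<Delta> n q \<Longrightarrow> set \<Delta> \<subseteq> set \<Delta>' \<Longrightarrow> n \<le> n' \<Longrightarrow> recorded \<Delta>' n' q"
proof (induction \<Delta> n q rule: recorded.induct)
  case (1 \<Delta> n k P l Q R)
  then obtain m \<sigma> \<tau> where "m \<le> n" "(m, ren_tm \<sigma> P, ren_tm \<tau> Q) \<in> set \<Delta>" "kernel k l \<sigma> \<tau> = R"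
    by auto
  with 1 have "m \<le> n'" "(m, ren_tm \<sigma> P, ren_tm \<tau> Q) \<in> set \<Delta>'" by auto
  with \<open>kernel k l \<sigma> \<tau> = R\<close> show ?case by auto
qed

text \<open>The renaming \<open>\<rho>\<close> from \<open>kernel_eq_factor\<close> turns the stored
  pair into the present one, since a scoped subterm sees a renaming only on its own context.\<close>

lemma eq_tm_if_recorded:
  assumes "recorded \<Delta> n ((k, P), (l, Q), kernel k l \<sigma> \<tau>)"
    and "scoped_tm k P" "scoped_tm l Q" "\<forall>i<k. \<sigma> i < n" "\<forall>i<l. \<tau> i < n"
    and "ren_tm \<sigma> P = Neu H S" "ren_tm \<tau> Q = Neu H' S'"
  shows "eq_tm \<Sigma> \<Delta> n (Neu H S) (Neu H' S')"
proof -
  from assms(1) obtain m \<sigma>0 \<tau>0 where *: "m \<le> n" "(m, ren_tm \<sigma>0 P, ren_tm \<tau>0 Q) \<in> set \<Delta>"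
    "kernel k l \<sigma>0 \<tau>0 = kernel k l \<sigma> \<tau>" by auto
  from kernel_eq_factor[OF *(3) assms(4,5) *(1)] obtain \<rho> where
    \<rho>: "\<forall>i<m. \<rho> i < n" "\<forall>i<k. \<rho> (\<sigma>0 i) = \<sigma> i" "\<forall>i<l. \<rho> (\<tau>0 i) = \<tau> i" .
  have "ren_tm \<rho> (ren_tm \<sigma>0 P) = Neu H S" "ren_tm \<rho> (ren_tm \<tau>0 Q) = Neu H' S'"
    using ren_cong(1)[OF assms(2), of "\<rho> \<circ> \<sigma>0" \<sigma>] ren_cong(1)[OF assms(3), of "\<rho> \<circ> \<tau>0" \<tau>] \<rho> assms(6,7)
    by (simp_all add: ren_comp)
  moreover obtain G T G' T' where "ren_tm \<sigma>0 P = Neu G T" "ren_tm \<tau>0 Q = Neu G' T'"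
    using assms(6,7) by (auto simp: ren_tm_eq_Neu)
  ultimately show ?thesis using eq_assm[of m G T G' T' \<Delta> \<rho> n \<Sigma>] *(2) \<rho>(1) by simp
qed

subsection \<open>Completeness\<close>

text \<open>\<open>U\<close> supplies the finitely many raw terms from which all terms of a
  derivation arise by renaming. Bodies of recursion constants are closed, hence their context length
  0.\<close>

locale subterm_closed =
  fixes \<Sigma> :: signature and U :: "(nat \<times> tm) set"
  assumes sig: "colf_signature \<Sigma>"
    and fin: "finite U"
    and scoped: "(k, P) \<in> U \<Longrightarrow> scoped_tm k P"
    and Lam_closed: "(k, Lam P) \<in> U \<Longrightarrow> (Suc k, P) \<in> U"
    and args_closed: "(k, Neu H S) \<in> U \<Longrightarrow> P \<in> args S \<Longrightarrow> (k, P) \<in> U"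
    and body_closed: "Rec_decl r A P \<in> set \<Sigma> \<Longrightarrow> (0, P) \<in> U"
begin

lemma dist: "distinct (map decl_name \<Sigma>)"
  using sig by (simp add: colf_signature_def)

definition inst :: "nat \<Rightarrow> tm \<Rightarrow> nat \<Rightarrow> tm \<Rightarrow> (nat \<Rightarrow> nat) \<Rightarrow> bool" where
  "inst n M k P \<sigma> \<longleftrightarrow> (k, P) \<in> U \<and> (\<forall>i<k. \<sigma> i < n) \<and> M = ren_tm \<sigma> P"

lemma inst_Lam: "inst n (Lam M) k P \<sigma> \<Longrightarrow> \<exists>Q. inst (Suc n) M (Suc k) Q (lift \<sigma>)"
  by (auto simp: inst_def ren_tm_eq_Lam[of \<sigma> P M] lift_def eq_commute[of "Lam M"]
      split: nat.split intro: Lam_closed)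

lemma inst_args: "inst n (Neu H S) k P \<sigma> \<Longrightarrow> M \<in> args S \<Longrightarrow> \<exists>Q. inst n M k Q \<sigma>"
  by (auto simp: inst_def ren_tm_eq_Neu eq_commute[of "Neu H S"]) (blast intro: args_closed)

text \<open>A prepattern spine meets only the renaming clause of \<open>reduce\<close>, so each step
  strips one abstraction from the subterm and extends the renaming by one variable; no hereditary
  substitution creates new terms. The empty spine is accepted only against a neutral term.\<close>

lemma inst_reduce:
  assumes "reduce \<tau> S M = Some N" "prepat S" "scoped_spine n S" "inst n M k P \<sigma>" "contra M"
  shows "\<exists>l Q \<rho>. inst n N l Q \<rho> \<and> contra N \<and> (\<exists>H T. N = Neu H T)"
  using assms
proof (induction S arbitrary: \<tau> M k P \<sigma> rule: spine_arg_induct)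
  case Nil_sp
  then show ?case by (cases \<tau>; cases M) auto
next
  case (PArg y S)
  from PArg.prems(1) obtain \<tau>' M' where
    *: "M = Lam M'" "reduce \<tau>' S (ren_tm (case_nat y (\<lambda>i. i)) M') = Some N"
    by (cases "(\<tau>, PArg y S, M)" rule: reduce.cases) auto
  from PArg.prems(4) * obtain Q where Q: "P = Lam Q" "M' = ren_tm (lift \<sigma>) Q"
    by (auto simp: inst_def ren_tm_eq_Lam eq_commute[of "Lam M'"])
  \<comment> \<open>Instantiating index 0 by \<open>y\<close> after passing under the binder amounts
    to extending \<open>\<sigma>\<close> by \<open>y\<close>.\<close>
  have "case_nat y (\<lambda>i. i) \<circ> lift \<sigma> = case_nat y \<sigma>"
    by (rule ext) (simp add: lift_def split: nat.split)
  then have "inst n (ren_tm (case_nat y (\<lambda>i. i)) M') (Suc k) Q (case_nat y \<sigma>)"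
    using PArg.prems(3,4) Q by (auto simp: inst_def ren_comp Lam_closed split: nat.split)
  from PArg.IH[OF *(2) _ _ this] PArg.prems * show ?case by auto
qed auto

text \<open>The reduct comes from a subterm of the body of \<open>r\<close>; it is neutral and
  contractive, so its head is not unfolded again.\<close>

lemma inst_unfold:
  assumes "Rec_decl r A M \<in> set \<Sigma>" "prepat S" "reduce (erase A) S M = Some N"
    and "inst n (Neu (Rec r) S) k P \<sigma>"
  obtains l Q \<rho> H T where "inst n N l Q \<rho>" "contra M" "N = Neu H T" "contra (Neu H T)"
proof -
  have "scoped_spine n S"
    using assms(2,4) scoped[of k P]
    by (auto simp: inst_def ren_tm_eq_Neu eq_commute[of "Neu (Rec r) S"] intro!: scoped_ren_spine)
  moreover have "inst n M 0 M id"
    using assms(1) body_closed by (auto simp: inst_def ren_id)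
  moreover have "contra M" using sig assms(1) unfolding colf_signature_def by blast
  ultimately show thesis using inst_reduce[OF assms(3,2)] that by blast
qed

section \<open>The termination measure\<close>

definition fresh :: "assumption list \<Rightarrow> nat \<Rightarrow> pair_key set" where
  "fresh \<Delta> n = {q \<in> keys U. \<not> recorded \<Delta> n q}"

text \<open>A larger context lets more assumptions count as recorded, so passing under a binder
  cannot increase the measure.\<close>

lemma card_fresh_mono: "n \<le> n' \<Longrightarrow> card (fresh \<Delta> n') \<le> card (fresh \<Delta> n)"
  by (rule card_mono) (auto simp: fresh_def finite_keys fin intro: recorded_mono)

text \<open>The new assumption records the key of the current pair, with the current renamings as
  witnesses.\<close>

lemma card_fresh_less:
  assumes "inst n M k P \<sigma>" "inst n M' l Q \<tau>"
    and "\<not> recorded \<Delta> n ((k, P), (l, Q), kernel k l \<sigma> \<tau>)"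
  shows "card (fresh ((n, M, M') # \<Delta>) n) < card (fresh \<Delta> n)"
proof (rule psubset_card_mono)
  let ?q = "((k, P), (l, Q), kernel k l \<sigma> \<tau>)"
  show "finite (fresh \<Delta> n)" by (simp add: fresh_def finite_keys fin)
  have "fresh ((n, M, M') # \<Delta>) n \<subseteq> fresh \<Delta> n"
    by (auto simp: fresh_def dest: recorded_mono[of \<Delta> n _ "(n, M, M') # \<Delta>" n])
  moreover have "recorded ((n, M, M') # \<Delta>) n ?q" using assms(1,2) by (auto simp: inst_def)
  then have "?q \<notin> fresh ((n, M, M') # \<Delta>) n" by (simp add: fresh_def)
  moreover have "?q \<in> fresh \<Delta> n" using assms by (auto simp: fresh_def inst_def kernel_in_keys)
  ultimately show "fresh ((n, M, M') # \<Delta>) n \<subset> fresh \<Delta> n" by blast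
qed

text \<open>Lexicographic induction on the number of fresh keys and the size of the left term. One
  size suffices, since agreement decomposes both sides at once.\<close>

lemma eq_tm_if_agree:
  assumes "agree \<Sigma> M M'" "inst n M k P \<sigma>" "inst n M' l Q \<tau>"
  shows "eq_tm \<Sigma> \<Delta> n M M'"
  using assms
proof (induction "(card (fresh \<Delta> n), size M)" arbitrary: \<Delta> n M M' k P \<sigma> l Q \<tau>
    rule: wf_induct_rule[OF wf_lex_prod[OF wf_less_than wf_less_than]])
  case 1
  note agr = 1(2) and inst = 1(3,4)
  note IH = 1(1)[simplified]
  show ?case
  proof (cases "\<exists>H S H' S'. M = Neu H S \<and> M' = Neu H' S'")
    case True
    then obtain H S H' S' where M: "M = Neu H S" and M': "M' = Neu H' S'" by blast
    \<comment> \<open>The assumption rule takes precedence; hence any unfolding concerns an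
      unrecorded key and lowers the measure.\<close>
    show ?thesis
    proof (cases "recorded \<Delta> n ((k, P), (l, Q), kernel k l \<sigma> \<tau>)")
      case True
      then show ?thesis
        using eq_tm_if_recorded[of \<Delta> n k P l Q \<sigma> \<tau> H S H' S'] inst scoped M M'
        by (auto simp: inst_def)
    next
      case False
      note less = card_fresh_less[OF inst False]
      consider r where "H = Rec r" | r where "\<forall>r. H \<noteq> Rec r" "H' = Rec r"
        | "contra M" "contra M'" using M M' by auto
      then show ?thesis
      proof cases
        case 1
        with agree_Rec[OF dist] agr M obtain A D N where
          D: "Rec_decl r A D \<in> set \<Sigma>" "prepat S" "reduce (erase A) S D = Some N" "agree \<Sigma> N M'"
          by metis
        obtain l' Q' \<rho> where "inst n N l' Q' \<rho>" "contra D"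
          using inst_unfold[OF D(1-3)] inst(1) M 1 by metis
        \<comment> \<open>The reduct may be larger than \<open>M\<close>, but the added assumption
          lowers the number of fresh keys.\<close>
        moreover from this have "eq_tm \<Sigma> ((n, M, M') # \<Delta>) n N M'"
          using IH[OF _ D(4) _ inst(2)] less by blast
        ultimately show ?thesis using D M M' 1 by (auto intro: eq_unfold_left)
      next
        case 2
        with agree_Rec[OF dist] agree_sym[OF agr] M' obtain A D N where
          D: "Rec_decl r A D \<in> set \<Sigma>" "prepat S'" "reduce (erase A) S' D = Some N" "agree \<Sigma> N M"
          by metis
        obtain l' Q' \<rho> where "inst n N l' Q' \<rho>" "contra D"
          using inst_unfold[OF D(1-3)] inst(2) M' 2 by metis
        moreover from this have "eq_tm \<Sigma> ((n, M, M') # \<Delta>) n M N"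
          using IH[OF _ agree_sym[OF D(4)] inst(1)] less by blast
        ultimately show ?thesis using D M M' 2 by (auto intro: eq_unfold_right)
      next
        case 3
        with agr M M' have H: "H' = H" and agr': "agree_spine \<Sigma> S S'"
          using agree_Neu[of \<Sigma> H S H' S'] by auto
        have "eq_tm \<Sigma> \<Delta> n N N'" if N: "N \<in> args S" "N' \<in> args S'" "agree \<Sigma> N N'" for N N'
        proof -
          obtain Q1 Q2 where "inst n N k Q1 \<sigma>" "inst n N' l Q2 \<tau>"
            using inst_args inst N M M' by metis
          moreover have "size N < size M" using size_args[OF N(1)] M by simp
          ultimately show ?thesis using IH[OF _ N(3)] by blast
        qed
        with agr' have "eq_spine \<Sigma> \<Delta> n S S'" by (rule eq_spine_if_agree)
        then show ?thesis using 3 M M' H by (cases H) (auto intro: eq_con eq_var)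
      qed
    qed
  next
    case False
    \<comment> \<open>A neutral term unfolds, if at all, to a contractive neutral one, so its tree
      cannot begin with an abstraction. By symmetry this excludes both mixed shapes.\<close>
    have no: False if LN: "agree \<Sigma> (Lam N) (Neu H S)" "inst n (Neu H S) k P \<sigma>" for N H S k P \<sigma>
    proof (cases "\<exists>r. H = Rec r")
      case True
      then obtain r where H: "H = Rec r" by blast
      with agree_Rec[OF dist] agree_sym[OF LN(1)] obtain A D N' where
        D: "Rec_decl r A D \<in> set \<Sigma>" "prepat S" "reduce (erase A) S D = Some N'" "agree \<Sigma> N' (Lam N)"
        by metis
      obtain G T where "N' = Neu G T" "contra (Neu G T)"
        using inst_unfold[OF D(1-3)] LN(2) H by metis
      then show ?thesis using not_agree_Lam_Neu agree_sym[OF D(4)] by blast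
    next
      case False
      then show ?thesis using not_agree_Lam_Neu[OF LN(1)] by simp
    qed
    obtain N N' where M: "M = Lam N" "M' = Lam N'"
      using False no agr agree_sym[OF agr] inst by (cases M; cases M') blast+
    from inst_Lam inst M obtain Q1 Q2 where
      "inst (Suc n) N (Suc k) Q1 (lift \<sigma>)" "inst (Suc n) N' (Suc l) Q2 (lift \<tau>)" by metis
    moreover have "agree \<Sigma> N N'" using agr M agree_Lam by simp
    moreover have "card (fresh \<Delta> (Suc n)) \<le> card (fresh \<Delta> n)" by (rule card_fresh_mono) simp
    moreover have "size N < size M" using M by simp
    ultimately have "eq_tm \<Sigma> \<Delta> (Suc n) N N'" using IH le_neq_implies_less by blast
    then show ?thesis using M by (auto intro: eq_lam)
  qed
qed

end

theorem theorem3: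
  fixes \<Sigma> :: signature and n :: nat and M M' :: tm and B :: btree
  assumes "colf_signature \<Sigma>"
    and "rational \<Sigma> M" and "rational \<Sigma> M'"
    and "scoped_tm n M" and "scoped_tm n M'"
    and "expansion \<Sigma> M = Some B" and "expansion \<Sigma> M' = Some B"
  shows "eq_tm \<Sigma> [] n M M'"
proof -
  \<comment> \<open>The roots are the two terms and all recursion bodies; other declarations are
    sent to \<open>(n, M)\<close>, which is a root anyway.\<close>
  define V where "V = {(n, M), (n, M')} \<union>
    (\<lambda>d. case d of Rec_decl r A P \<Rightarrow> (0, P) | _ \<Rightarrow> (n, M)) ` set \<Sigma>"
  define U where "U = (\<Union>(k, P)\<in>V. subs_tm P k)"
  have body: "(0, P) \<in> V" if "Rec_decl r A P \<in> set \<Sigma>" for r A P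
    using that by (force simp: V_def)
  have V: "scoped_tm k P" if "(k, P) \<in> V" for k P
    using that assms(1,4,5) by (auto simp: V_def colf_signature_def split: decl.splits)
  have sub: "(k, P) \<in> U" if "(k, P) \<in> V" for k P
    using that subs_refl by (fastforce simp: U_def)
  interpret subterm_closed \<Sigma> U
  proof
    show "finite U" by (auto simp: U_def V_def finite_subs split: decl.split)
    show "scoped_tm k P" if "(k, P) \<in> U" for k P
      using that V scoped_subs(1) by (fastforce simp: U_def)
    show "(Suc k, P) \<in> U" if "(k, Lam P) \<in> U" for k P
      using that subs_Lam(1) by (fastforce simp: U_def)
    show "(k, P) \<in> U" if "(k, Neu H S) \<in> U" "P \<in> args S" for k H S P
      using that subs_args(1) by (fastforce simp: U_def)
    show "(0, P) \<in> U" if "Rec_decl r A P \<in> set \<Sigma>" for r A P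
      using body[OF that] by (rule sub)
  qed (rule assms(1))
  have "agree \<Sigma> M M'"
    using assms(6,7) expansion_eq_Some_iff[OF assms(1)] agree_if_expansion_eq by blast
  moreover have "inst n M n M id" "inst n M' n M' id"
    using sub by (auto simp: inst_def ren_id V_def)
  ultimately show ?thesis by (rule eq_tm_if_agree)
qed

end
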